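(* Let $\mathbf{OrdTop}_{OC}^{\bullet}$ be the category of ordered topological spaces with open cones and enough points, with continuous monotone functions as morphisms, and let $\mathbf{OrdLoc}^{\bullet}$ be the category of ordered locales satisfying axiom $(\bullet)$ (i.e. $U\trianglelefteq V$ in $X$ implies $\mathrm{pt}(U)\trianglelefteq\mathrm{pt}(V)$ in $\mathrm{Loc}(\mathrm{pt}(X))$), with monotone maps of locales as morphisms. Then the assignments $(S,\leq)\mapsto(\mathrm{Loc}(S),\trianglelefteq)$, $g\mapsto \mathrm{Loc}(g)$ and $(X,\trianglelefteq)\mapsto(\mathrm{pt}(X),\leq)$, $f\mapsto\mathrm{pt}(f)$ define functors which form an adjunction $$\mathrm{Loc}\dashv\mathrm{pt},\qquad \mathrm{Loc}\colon \mathbf{OrdTop}_{OC}^{\bullet}\longrightarrow\mathbf{OrdLoc}^{\bullet},\qquad \mathrm{pt}\colon\mathbf{OrdLoc}^{\bullet}\longrightarrow\mathbf{OrdTop}_{OC}^{\bullet}.$$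
   Context: A locale $X$ is given by a frame $\mathcal{O}X$ (order $\sqsubseteq$, bottom $\varnothing$, top $X$); a map of locales $f\colon X\to Y$ is a frame homomorphism $f^{-1}\colon\mathcal{O}Y\to\mathcal{O}X$. Ordered locale: a pair $(X,\trianglelefteq)$ of a locale $X$ and a preorder $\trianglelefteq$ on $\mathcal{O}X$ such that $U_i\trianglelefteq V_i$ for all $i\in I$ implies $\bigvee_i U_i\trianglelefteq\bigvee_i V_i$ (any index set $I$). Monotone map: a map of locales $f\colon X\to Y$ between ordered locales is monotone if (upper) whenever $U\trianglelefteq U'$ in $\mathcal{O}X$ and $U\sqsubseteq f^{-1}(V)$ there is $V'$ with $V\trianglelefteq V'$ and $U'\sqsubseteq f^{-1}(V')$; and (lower) whenever $U\trianglelefteq U'$ and $U'\sqsubseteq f^{-1}(V')$ there is $V$ with $V\trianglelefteq V'$ and $U\sqsubseteq f^{-1}(V)$. Ordered space: a topological space $S$ with a preorder $\leq$ on its set of elements (no compatibility assumed). For $A\subseteq S$: $\uparrow A=\{x:\exists a\in A,\ a\leq x\}$, $\downarrow A=\{x:\exists a\in A,\ x\leq a\}$. $S$ has open cones if $\uparrow U$ and $\downarrow U$ are open for every open $U$. $S$ has enough points if every completely prime filter of $\mathcal{O}S$ is of the form $\{U\in\mathcal{O}S: x\in U\}$ for some $x\in S$. $\mathrm{Loc}(S)$ is the locale with frame $\mathcal{O}S$ of open sets, ordered by the Egli–Milner order: $U\trianglelefteq V$ iff $U\subseteq\downarrow V$ and $V\subseteq\uparrow U$. For $g\colon S\to T$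 continuous, $\mathrm{Loc}(g)^{-1}=g^{-1}$. $\mathrm{pt}(X)$ is the set of completely prime filters $\mathcal{F}\subseteq\mathcal{O}X$, with open sets $\mathrm{pt}(U)=\{\mathcal{F}: U\in\mathcal{F}\}$, $U\in\mathcal{O}X$; it is preordered by: $\mathcal{F}\leq\mathcal{G}$ iff $\forall U\in\mathcal{F}\,\exists V\in\mathcal{G}\colon U\trianglelefteq V$ and $\forall V\in\mathcal{G}\,\exists U\in\mathcal{F}\colon U\trianglelefteq V$. For $f\colon X\to Y$, $\mathrm{pt}(f)(\mathcal{F})=\{V\in\mathcal{O}Y: f^{-1}(V)\in\mathcal{F}\}$. In axiom $(\bullet)$, the relation $\mathrm{pt}(U)\trianglelefteq\mathrm{pt}(V)$ is the Egli–Milner order of the ordered space $\mathrm{pt}(X)$. *)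

theory Defs
  imports "HOL-Analysis.Abstract_Topology" "HOL-Algebra.Complete_Lattice"
begin

text \<open>
  Objects of both categories are carrier-based, so that \<open>Loc\<close> and \<open>pt\<close> can be defined on them;
  they live over an arbitrary type \<open>'a\<close>. Since \<open>Loc\<close> and \<open>pt\<close> both lead from \<open>'a\<close> to \<open>'a set\<close>,
  hom-sets are defined between objects over different types. Morphisms are functions that are
  undefined outside the carrier (\<^const>\<open>extensional\<close>), so equality of morphisms is equality of
  functions.
\<close>

section \<open>Locales and ordered locales\<close>

locale frame = complete_lattice X for X (structure) +
  assumes inf_sup_distrib:
    "U \<in> carrier X \<Longrightarrow> A \<subseteq> carrier X \<Longrightarrow> U \<sqinter> (\<Squnion>A) = \<Squnion>((\<lambda>V. U \<sqinter> V) ` A)"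

definition frame_hom :: "('a, 'm) gorder_scheme \<Rightarrow> ('b, 'n) gorder_scheme \<Rightarrow> ('a \<Rightarrow> 'b) set" where
  "frame_hom L M = {h \<in> carrier L \<rightarrow>\<^sub>E carrier M.
     h \<top>\<^bsub>L\<^esub> = \<top>\<^bsub>M\<^esub> \<and>
     (\<forall>U\<in>carrier L. \<forall>V\<in>carrier L. h (U \<sqinter>\<^bsub>L\<^esub> V) = h U \<sqinter>\<^bsub>M\<^esub> h V) \<and>
     (\<forall>A\<subseteq>carrier L. h (\<Squnion>\<^bsub>L\<^esub>A) = \<Squnion>\<^bsub>M\<^esub>(h ` A))}"

record 'a ordered_locale = "'a gorder" +
  cone_rel :: "'a rel"

abbreviation cone_le :: "('a, 'm) ordered_locale_scheme \<Rightarrow> 'a \<Rightarrow> 'a \<Rightarrow> bool"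
    (\<open>(_ \<unlhd>\<index> _)\<close> [51, 51] 50) where
  "U \<unlhd>\<^bsub>X\<^esub> V \<equiv> (U, V) \<in> cone_rel X"

text \<open>
  A family of pairs \<open>U\<^sub>i \<unlhd> V\<^sub>i\<close> is given by its set \<open>R\<close> of members; the joins depend on
  this set only, so no index type is needed.
\<close>

definition is_ordered_locale :: "'a ordered_locale \<Rightarrow> bool" where
  "is_ordered_locale X \<longleftrightarrow>
     frame X \<and> preorder_on (carrier X) (cone_rel X) \<and>
     (\<forall>R\<subseteq>cone_rel X. (\<Squnion>\<^bsub>X\<^esub>(fst ` R)) \<unlhd>\<^bsub>X\<^esub> (\<Squnion>\<^bsub>X\<^esub>(snd ` R)))"

text \<open>A map of locales \<open>f : X \<rightarrow> Y\<close> is represented by the frame homomorphism \<open>f\<^sup>-\<^sup>1 : \<O>Y \<rightarrow> \<O>X\<close>.\<close>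

definition locale_hom :: "'a ordered_locale \<Rightarrow> 'b ordered_locale \<Rightarrow> ('b \<Rightarrow> 'a) set" where
  "locale_hom X Y = {f \<in> frame_hom Y X.
     (\<forall>U U' V. U \<unlhd>\<^bsub>X\<^esub> U' \<and> V \<in> carrier Y \<and> U \<sqsubseteq>\<^bsub>X\<^esub> f V \<longrightarrow>
        (\<exists>V'\<in>carrier Y. V \<unlhd>\<^bsub>Y\<^esub> V' \<and> U' \<sqsubseteq>\<^bsub>X\<^esub> f V')) \<and>
     (\<forall>U U' V'. U \<unlhd>\<^bsub>X\<^esub> U' \<and> V' \<in> carrier Y \<and> U' \<sqsubseteq>\<^bsub>X\<^esub> f V' \<longrightarrow>
        (\<exists>V\<in>carrier Y. V \<unlhd>\<^bsub>Y\<^esub> V' \<and> U \<sqsubseteq>\<^bsub>X\<^esub> f V))}"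

definition locale_id :: "'a ordered_locale \<Rightarrow> 'a \<Rightarrow> 'a" where
  "locale_id X = (\<lambda>U\<in>carrier X. U)"

text \<open>\<open>locale_comp Z h f\<close> is \<open>h \<circ> f\<close> for \<open>f : X \<rightarrow> Y\<close> and \<open>h : Y \<rightarrow> Z\<close>, i.e. \<open>U \<mapsto> f\<^sup>-\<^sup>1 (h\<^sup>-\<^sup>1 U)\<close>.\<close>

definition locale_comp :: "'c ordered_locale \<Rightarrow> ('c \<Rightarrow> 'b) \<Rightarrow> ('b \<Rightarrow> 'a) \<Rightarrow> 'c \<Rightarrow> 'a" where
  "locale_comp Z h f = compose (carrier Z) f h"

definition cp_filter :: "('a, 'm) gorder_scheme \<Rightarrow> 'a set \<Rightarrow> bool" where
  "cp_filter X F \<longleftrightarrow>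
     F \<subseteq> carrier X \<and> \<top>\<^bsub>X\<^esub> \<in> F \<and>
     (\<forall>U\<in>F. \<forall>V\<in>carrier X. U \<sqsubseteq>\<^bsub>X\<^esub> V \<longrightarrow> V \<in> F) \<and>
     (\<forall>U\<in>F. \<forall>V\<in>F. U \<sqinter>\<^bsub>X\<^esub> V \<in> F) \<and>
     (\<forall>A\<subseteq>carrier X. \<Squnion>\<^bsub>X\<^esub>A \<in> F \<longrightarrow> (\<exists>U\<in>A. U \<in> F))"

section \<open>Ordered spaces\<close>

record 'a ordered_space =
  space_top :: "'a topology"
  space_le :: "'a rel"  \<comment> \<open>\<open>(x, y) \<in> space_le S\<close> means \<open>x \<le> y\<close>\<close>

abbreviation points :: "'a ordered_space \<Rightarrow> 'a set" where
  "points S \<equiv> topspace (space_top S)"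

abbreviation is_open :: "'a ordered_space \<Rightarrow> 'a set \<Rightarrow> bool" where
  "is_open S \<equiv> openin (space_top S)"

definition is_ordered_space :: "'a ordered_space \<Rightarrow> bool" where
  "is_ordered_space S \<longleftrightarrow> preorder_on (points S) (space_le S)"

definition up_cone :: "'a ordered_space \<Rightarrow> 'a set \<Rightarrow> 'a set" where
  "up_cone S A = {x. \<exists>a\<in>A. (a, x) \<in> space_le S}"

definition down_cone :: "'a ordered_space \<Rightarrow> 'a set \<Rightarrow> 'a set" where
  "down_cone S A = {x. \<exists>a\<in>A. (x, a) \<in> space_le S}"

definition open_cones :: "'a ordered_space \<Rightarrow> bool" where
  "open_cones S \<longleftrightarrow> (\<forall>U. is_open S U \<longrightarrow> is_open S (up_cone S U) \<and> is_open S (down_cone S U))"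

definition space_hom :: "'a ordered_space \<Rightarrow> 'b ordered_space \<Rightarrow> ('a \<Rightarrow> 'b) set" where
  "space_hom S T = {g \<in> points S \<rightarrow>\<^sub>E points T.
     continuous_map (space_top S) (space_top T) g \<and>
     (\<forall>x y. (x, y) \<in> space_le S \<longrightarrow> (g x, g y) \<in> space_le T)}"

definition space_id :: "'a ordered_space \<Rightarrow> 'a \<Rightarrow> 'a" where
  "space_id S = (\<lambda>x\<in>points S. x)"

definition space_comp :: "'a ordered_space \<Rightarrow> ('b \<Rightarrow> 'c) \<Rightarrow> ('a \<Rightarrow> 'b) \<Rightarrow> 'a \<Rightarrow> 'c" where
  "space_comp S h g = compose (points S) h g"

section \<open>The assignments \<open>Loc\<close> and \<open>pt\<close>\<close>

definition Loc :: "'a ordered_space \<Rightarrow> 'a set ordered_locale" where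
  "Loc S = \<lparr>carrier = {U. is_open S U}, eq = (=), le = (\<subseteq>),
     cone_rel = {(U, V). is_open S U \<and> is_open S V \<and> U \<subseteq> down_cone S V \<and> V \<subseteq> up_cone S U}\<rparr>"

definition Loc_map :: "'a ordered_space \<Rightarrow> 'b ordered_space \<Rightarrow> ('a \<Rightarrow> 'b) \<Rightarrow> 'b set \<Rightarrow> 'a set" where
  "Loc_map S T g = (\<lambda>V\<in>carrier (Loc T). {x \<in> points S. g x \<in> V})"

definition enough_points :: "'a ordered_space \<Rightarrow> bool" where
  "enough_points S \<longleftrightarrow>
     (\<forall>F. cp_filter (Loc S) F \<longrightarrow> (\<exists>x\<in>points S. F = {U. is_open S U \<and> x \<in> U}))"

definition pt_open :: "('a, 'm) gorder_scheme \<Rightarrow> 'a \<Rightarrow> 'a set set" where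
  "pt_open X U = {F. cp_filter X F \<and> U \<in> F}"

definition pt :: "'a ordered_locale \<Rightarrow> 'a set ordered_space" where
  "pt X = \<lparr>space_top = topology (\<lambda>W. \<exists>U\<in>carrier X. W = pt_open X U),
     space_le = {(F, G). cp_filter X F \<and> cp_filter X G \<and>
       (\<forall>U\<in>F. \<exists>V\<in>G. U \<unlhd>\<^bsub>X\<^esub> V) \<and> (\<forall>V\<in>G. \<exists>U\<in>F. U \<unlhd>\<^bsub>X\<^esub> V)}\<rparr>"

definition pt_map :: "'a ordered_locale \<Rightarrow> 'b ordered_locale \<Rightarrow> ('b \<Rightarrow> 'a) \<Rightarrow> 'a set \<Rightarrow> 'b set" where
  "pt_map X Y f = (\<lambda>F\<in>{F. cp_filter X F}. {V \<in> carrier Y. f V \<in> F})"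

section \<open>The two categories\<close>

definition OrdTop_OC_bullet :: "'a ordered_space set" where
  "OrdTop_OC_bullet = {S. is_ordered_space S \<and> open_cones S \<and> enough_points S}"

definition axiom_bullet :: "'a ordered_locale \<Rightarrow> bool" where
  "axiom_bullet X \<longleftrightarrow>
     (\<forall>U V. U \<unlhd>\<^bsub>X\<^esub> V \<longrightarrow> pt_open X U \<unlhd>\<^bsub>Loc (pt X)\<^esub> pt_open X V)"

definition OrdLoc_bullet :: "'a ordered_locale set" where
  "OrdLoc_bullet = {X. is_ordered_locale X \<and> axiom_bullet X}"

text \<open>The transpose of \<open>f : Loc S \<rightarrow> X\<close> sends \<open>x\<close> to the filter of all \<open>U\<close> with \<open>x \<in> f\<^sup>-\<^sup>1 U\<close>.\<close>

definition adj_transpose ::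
    "'a ordered_space \<Rightarrow> 'b ordered_locale \<Rightarrow> ('b \<Rightarrow> 'a set) \<Rightarrow> 'a \<Rightarrow> 'b set" where
  "adj_transpose S X f = (\<lambda>x\<in>points S. {U \<in> carrier X. x \<in> f U})"

subsection \<open>The category laws\<close>

lemma space_id_hom: "is_ordered_space S \<Longrightarrow> space_id S \<in> space_hom S S"
  unfolding space_hom_def space_id_def is_ordered_space_def preorder_on_def
  by (auto intro!: continuous_map_eq[OF continuous_map_id])

lemma space_comp_hom:
  assumes g: "g \<in> space_hom S T" and h: "h \<in> space_hom T R" and S: "is_ordered_space S"
  shows "space_comp S h g \<in> space_hom S R"
proof -
  have "continuous_map (space_top S) (space_top R) (h \<circ> g)"
    using g h by (auto simp: space_hom_def intro: continuous_map_compose)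
  then have "continuous_map (space_top S) (space_top R) (compose (points S) h g)"
    by (rule continuous_map_eq) (simp add: compose_def)
  moreover have "compose (points S) h g \<in> points S \<rightarrow>\<^sub>E points R"
    using g h by (auto simp: space_hom_def compose_def)
  moreover have "(compose (points S) h g x, compose (points S) h g y) \<in> space_le R"
    if "(x, y) \<in> space_le S" for x y
  proof -
    have "x \<in> points S" "y \<in> points S"
      using S that by (auto simp: is_ordered_space_def preorder_on_def)
    then show ?thesis using g h that by (simp add: space_hom_def compose_def)
  qed
  ultimately show ?thesis by (simp add: space_hom_def space_comp_def)
qed

lemma space_comp_id:
  assumes "g \<in> space_hom S T"
  shows "space_comp S (space_id T) g = g" "space_comp S g (space_id S) = g"
  using assms unfolding space_hom_def space_comp_def space_id_def
  by (auto simp: PiE_def intro!: Id_compose compose_Id)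

lemma space_comp_assoc:
  "g \<in> space_hom S T \<Longrightarrow>
    space_comp S k (space_comp S h g) = space_comp S (space_comp T k h) g"
  unfolding space_hom_def space_comp_def by (auto intro!: compose_assoc)

lemma cone_join:
  assumes X: "is_ordered_locale X" and "U \<unlhd>\<^bsub>X\<^esub> V" "U' \<unlhd>\<^bsub>X\<^esub> V'"
  shows "U \<squnion>\<^bsub>X\<^esub> U' \<unlhd>\<^bsub>X\<^esub> V \<squnion>\<^bsub>X\<^esub> V'"
proof -
  have "\<forall>R\<subseteq>cone_rel X. \<Squnion>\<^bsub>X\<^esub>(fst ` R) \<unlhd>\<^bsub>X\<^esub> \<Squnion>\<^bsub>X\<^esub>(snd ` R)"
    using X by (simp add: is_ordered_locale_def)
  then have "\<Squnion>\<^bsub>X\<^esub>(fst ` {(U, V), (U', V')}) \<unlhd>\<^bsub>X\<^esub> \<Squnion>\<^bsub>X\<^esub>(snd ` {(U, V), (U', V')})"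
    by (rule allE[where x = "{(U, V), (U', V')}"]) (use assms in simp)
  then show ?thesis by (simp add: join_def)
qed

lemma locale_homI:
  assumes "f \<in> frame_hom Y X"
    and "\<And>U U' V. U \<unlhd>\<^bsub>X\<^esub> U' \<Longrightarrow> V \<in> carrier Y \<Longrightarrow> U \<sqsubseteq>\<^bsub>X\<^esub> f V \<Longrightarrow>
      \<exists>V'\<in>carrier Y. V \<unlhd>\<^bsub>Y\<^esub> V' \<and> U' \<sqsubseteq>\<^bsub>X\<^esub> f V'"
    and "\<And>U U' V'. U \<unlhd>\<^bsub>X\<^esub> U' \<Longrightarrow> V' \<in> carrier Y \<Longrightarrow> U' \<sqsubseteq>\<^bsub>X\<^esub> f V' \<Longrightarrow>
      \<exists>V\<in>carrier Y. V \<unlhd>\<^bsub>Y\<^esub> V' \<and> U \<sqsubseteq>\<^bsub>X\<^esub> f V"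
  shows "f \<in> locale_hom X Y"
  using assms unfolding locale_hom_def by blast

lemma locale_hom_upper:
  assumes "f \<in> locale_hom X Y" "U \<unlhd>\<^bsub>X\<^esub> U'" "V \<in> carrier Y" "U \<sqsubseteq>\<^bsub>X\<^esub> f V"
  obtains V' where "V' \<in> carrier Y" "V \<unlhd>\<^bsub>Y\<^esub> V'" "U' \<sqsubseteq>\<^bsub>X\<^esub> f V'"
  using assms unfolding locale_hom_def by blast

lemma locale_hom_lower:
  assumes "f \<in> locale_hom X Y" "U \<unlhd>\<^bsub>X\<^esub> U'" "V' \<in> carrier Y" "U' \<sqsubseteq>\<^bsub>X\<^esub> f V'"
  obtains V where "V \<in> carrier Y" "V \<unlhd>\<^bsub>Y\<^esub> V'" "U \<sqsubseteq>\<^bsub>X\<^esub> f V"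
  using assms unfolding locale_hom_def by blast

lemma locale_id_hom:
  assumes X: "is_ordered_locale X"
  shows "locale_id X \<in> locale_hom X X"
proof -
  interpret frame X using X by (simp add: is_ordered_locale_def)
  have cone: "U \<in> carrier X" "V \<in> carrier X" if "U \<unlhd>\<^bsub>X\<^esub> V" for U V
    using that X by (auto simp: is_ordered_locale_def preorder_on_def)
  have refl: "U \<unlhd>\<^bsub>X\<^esub> U" if "U \<in> carrier X" for U
    using that X by (auto simp: is_ordered_locale_def preorder_on_def refl_on_def)
  have id: "locale_id X U = U" if "U \<in> carrier X" for U
    using that by (simp add: locale_id_def)
  have up: "\<exists>V'\<in>carrier X. V \<unlhd>\<^bsub>X\<^esub> V' \<and> U' \<sqsubseteq>\<^bsub>X\<^esub> locale_id X V'"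
    if UU: "U \<unlhd>\<^bsub>X\<^esub> U'" and V: "V \<in> carrier X" and le: "U \<sqsubseteq>\<^bsub>X\<^esub> locale_id X V" for U U' V
  proof (intro bexI conjI)
    have "U \<squnion>\<^bsub>X\<^esub> V = V" using le cone(1)[OF UU] V by (simp add: id le_iff_meet[symmetric])
    then show "V \<unlhd>\<^bsub>X\<^esub> U' \<squnion>\<^bsub>X\<^esub> V" using cone_join[OF X UU refl[OF V]] by simp
    show U'V: "U' \<squnion>\<^bsub>X\<^esub> V \<in> carrier X" using cone(2)[OF UU] V by simp
    show "U' \<sqsubseteq>\<^bsub>X\<^esub> locale_id X (U' \<squnion>\<^bsub>X\<^esub> V)"
      unfolding id[OF U'V] using cone(2)[OF UU] V by (rule join_left)
  qed
  have low: "\<exists>V\<in>carrier X. V \<unlhd>\<^bsub>X\<^esub> V' \<and> U \<sqsubseteq>\<^bsub>X\<^esub> locale_id X V"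
    if UU: "U \<unlhd>\<^bsub>X\<^esub> U'" and V: "V' \<in> carrier X" and le: "U' \<sqsubseteq>\<^bsub>X\<^esub> locale_id X V'" for U U' V'
  proof (intro bexI conjI)
    have "U' \<squnion>\<^bsub>X\<^esub> V' = V'" using le cone(2)[OF UU] V by (simp add: id le_iff_meet[symmetric])
    then show "U \<squnion>\<^bsub>X\<^esub> V' \<unlhd>\<^bsub>X\<^esub> V'" using cone_join[OF X UU refl[OF V]] by simp
    show UV: "U \<squnion>\<^bsub>X\<^esub> V' \<in> carrier X" using cone(1)[OF UU] V by simp
    show "U \<sqsubseteq>\<^bsub>X\<^esub> locale_id X (U \<squnion>\<^bsub>X\<^esub> V')"
      unfolding id[OF UV] using cone(1)[OF UU] V by (rule join_left)
  qed
  have "locale_id X ` A = A" if "A \<subseteq> carrier X" for A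
    using that by (force simp: locale_id_def)
  then have fh: "locale_id X \<in> frame_hom X X"
    by (simp add: frame_hom_def locale_id_def)
  show ?thesis by (rule locale_homI) (fact fh, fact up, fact low)
qed

lemma frame_hom_mono:
  assumes f: "f \<in> frame_hom L M" and L: "complete_lattice L" and M: "complete_lattice M"
    and UV: "U \<in> carrier L" "V \<in> carrier L" "U \<sqsubseteq>\<^bsub>L\<^esub> V"
  shows "f U \<sqsubseteq>\<^bsub>M\<^esub> f V"
proof -
  interpret L: complete_lattice L by fact
  interpret M: complete_lattice M by fact
  have "U = U \<sqinter>\<^bsub>L\<^esub> V" using UV by (simp add: L.le_iff_join[symmetric])
  moreover have "f (U \<sqinter>\<^bsub>L\<^esub> V) = f U \<sqinter>\<^bsub>M\<^esub> f V"
    using f UV by (simp add: frame_hom_def)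
  ultimately have "f U = f U \<sqinter>\<^bsub>M\<^esub> f V" by simp
  moreover have "f U \<in> carrier M" "f V \<in> carrier M"
    using f UV by (auto simp: frame_hom_def)
  ultimately show ?thesis by (simp only: M.le_iff_join)
qed

lemma locale_comp_hom:
  assumes f: "f \<in> locale_hom X Y" and h: "h \<in> locale_hom Y Z"
    and X: "is_ordered_locale X" and Y: "is_ordered_locale Y" and Z: "is_ordered_locale Z"
  shows "locale_comp Z h f \<in> locale_hom X Z"
proof -
  interpret X: frame X using X by (simp add: is_ordered_locale_def)
  interpret Y: frame Y using Y by (simp add: is_ordered_locale_def)
  interpret Z: frame Z using Z by (simp add: is_ordered_locale_def)
  have ff: "f \<in> frame_hom Y X" and gh: "h \<in> frame_hom Z Y"
    using f h by (simp_all add: locale_hom_def)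
  have fc: "f U \<in> carrier X" if "U \<in> carrier Y" for U
    using ff that by (auto simp: frame_hom_def)
  have hc: "h U \<in> carrier Y" if "U \<in> carrier Z" for U
    using gh that by (auto simp: frame_hom_def)
  have coneX: "U \<in> carrier X" "V \<in> carrier X" if "U \<unlhd>\<^bsub>X\<^esub> V" for U V
    using that X by (auto simp: is_ordered_locale_def preorder_on_def)
  note mono = frame_hom_mono[OF ff Y.complete_lattice_axioms X.complete_lattice_axioms]
  let ?c = "compose (carrier Z) f h"
  have cval: "?c U = f (h U)" if "U \<in> carrier Z" for U
    using that by (simp add: compose_def)
  have "?c (\<Squnion>\<^bsub>Z\<^esub>A) = \<Squnion>\<^bsub>X\<^esub>(?c ` A)" if A: "A \<subseteq> carrier Z" for A
  proof -
    have hA: "h ` A \<subseteq> carrier Y" using A hc by auto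
    have "?c ` A = f ` (h ` A)" using A by (force simp: compose_def)
    moreover have "f (\<Squnion>\<^bsub>Y\<^esub>(h ` A)) = \<Squnion>\<^bsub>X\<^esub>(f ` (h ` A))"
      using ff hA by (simp add: frame_hom_def)
    moreover have "h (\<Squnion>\<^bsub>Z\<^esub>A) = \<Squnion>\<^bsub>Y\<^esub>(h ` A)"
      using gh A by (simp add: frame_hom_def)
    ultimately show ?thesis using cval[OF Z.sup_closed[OF A]] by simp
  qed
  moreover have "?c (U \<sqinter>\<^bsub>Z\<^esub> V) = ?c U \<sqinter>\<^bsub>X\<^esub> ?c V" if "U \<in> carrier Z" "V \<in> carrier Z" for U V
    using ff gh that hc cval by (simp add: frame_hom_def)
  moreover have "?c \<top>\<^bsub>Z\<^esub> = \<top>\<^bsub>X\<^esub>"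
    using ff gh cval by (simp add: frame_hom_def)
  ultimately have fh: "?c \<in> frame_hom Z X"
    using fc hc by (simp add: frame_hom_def) (simp add: compose_def)
  have up: "\<exists>W'\<in>carrier Z. W \<unlhd>\<^bsub>Z\<^esub> W' \<and> U' \<sqsubseteq>\<^bsub>X\<^esub> ?c W'"
    if UU: "U \<unlhd>\<^bsub>X\<^esub> U'" and W: "W \<in> carrier Z" and le: "U \<sqsubseteq>\<^bsub>X\<^esub> ?c W" for U U' W
  proof -
    have "U \<sqsubseteq>\<^bsub>X\<^esub> f (h W)" using le cval[OF W] by simp
    then obtain V' where V': "V' \<in> carrier Y" "h W \<unlhd>\<^bsub>Y\<^esub> V'" "U' \<sqsubseteq>\<^bsub>X\<^esub> f V'"
      using locale_hom_upper[OF f UU hc[OF W]] by metis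
    obtain W' where W': "W' \<in> carrier Z" "W \<unlhd>\<^bsub>Z\<^esub> W'" "V' \<sqsubseteq>\<^bsub>Y\<^esub> h W'"
      using locale_hom_upper[OF h V'(2) W Y.le_refl[OF hc[OF W]]] by metis
    have "U' \<sqsubseteq>\<^bsub>X\<^esub> f (h W')"
      by (rule X.le_trans[OF V'(3) mono[OF V'(1) hc[OF W'(1)] W'(3)] coneX(2)[OF UU]
            fc[OF V'(1)] fc[OF hc[OF W'(1)]]])
    then show ?thesis using W' cval[OF W'(1)] by (intro bexI[of _ W'] conjI) simp_all
  qed
  have low: "\<exists>W\<in>carrier Z. W \<unlhd>\<^bsub>Z\<^esub> W' \<and> U \<sqsubseteq>\<^bsub>X\<^esub> ?c W"
    if UU: "U \<unlhd>\<^bsub>X\<^esub> U'" and W: "W' \<in> carrier Z" and le: "U' \<sqsubseteq>\<^bsub>X\<^esub> ?c W'" for U U' W'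
  proof -
    have "U' \<sqsubseteq>\<^bsub>X\<^esub> f (h W')" using le cval[OF W] by simp
    then obtain V where V: "V \<in> carrier Y" "V \<unlhd>\<^bsub>Y\<^esub> h W'" "U \<sqsubseteq>\<^bsub>X\<^esub> f V"
      using locale_hom_lower[OF f UU hc[OF W]] by metis
    obtain W2 where W2: "W2 \<in> carrier Z" "W2 \<unlhd>\<^bsub>Z\<^esub> W'" "V \<sqsubseteq>\<^bsub>Y\<^esub> h W2"
      using locale_hom_lower[OF h V(2) W Y.le_refl[OF hc[OF W]]] by metis
    have "U \<sqsubseteq>\<^bsub>X\<^esub> f (h W2)"
      by (rule X.le_trans[OF V(3) mono[OF V(1) hc[OF W2(1)] W2(3)] coneX(1)[OF UU]
            fc[OF V(1)] fc[OF hc[OF W2(1)]]])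
    then show ?thesis using W2 cval[OF W2(1)] by (intro bexI[of _ W2] conjI) simp_all
  qed
  show ?thesis unfolding locale_comp_def by (rule locale_homI) (fact fh, fact up, fact low)
qed

lemma locale_comp_id:
  assumes "f \<in> locale_hom X Y"
  shows "locale_comp Y (locale_id Y) f = f" "locale_comp Y f (locale_id X) = f"
  using assms unfolding locale_hom_def frame_hom_def locale_comp_def locale_id_def
  by (auto simp: PiE_def intro!: Id_compose compose_Id)

lemma locale_comp_assoc:
  "k \<in> locale_hom Z W \<Longrightarrow>
    locale_comp W k (locale_comp Z h f) = locale_comp W (locale_comp W k h) f"
  unfolding locale_hom_def frame_hom_def locale_comp_def by (auto intro!: compose_assoc[symmetric])

subsection \<open>The topology of \<open>pt X\<close>\<close>

context frame
begin

lemma pt_open_meet: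
  assumes UV: "U \<in> carrier X" "V \<in> carrier X"
  shows "pt_open X U \<inter> pt_open X V = pt_open X (U \<sqinter> V)"
proof -
  have "U \<sqinter> V \<in> F \<longleftrightarrow> U \<in> F \<and> V \<in> F" if F: "cp_filter X F" for F
  proof
    assume "U \<sqinter> V \<in> F"
    then have "W \<in> F" if "W \<in> carrier X" "U \<sqinter> V \<sqsubseteq> W" for W
      using F that by (simp add: cp_filter_def)
    from this[OF UV(1) meet_left[OF UV]] this[OF UV(2) meet_right[OF UV]]
    show "U \<in> F \<and> V \<in> F" by simp
  qed (use F in \<open>simp add: cp_filter_def\<close>)
  then show ?thesis by (simp add: pt_open_def set_eq_iff) metis
qed

lemma pt_open_Sup:
  assumes A: "A \<subseteq> carrier X"
  shows "\<Union>(pt_open X ` A) = pt_open X (\<Squnion>A)"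
proof -
  have "\<Squnion>A \<in> F \<longleftrightarrow> (\<exists>U\<in>A. U \<in> F)" if F: "cp_filter X F" for F
  proof
    assume "\<exists>U\<in>A. U \<in> F"
    then obtain U where U: "U \<in> A" "U \<in> F" by (elim bexE)
    then have "W \<in> F" if "W \<in> carrier X" "U \<sqsubseteq> W" for W
      using F that by (simp add: cp_filter_def)
    from this[OF sup_closed[OF A] sup_upper[OF A U(1)]] show "\<Squnion>A \<in> F" .
  qed (use F A in \<open>simp add: cp_filter_def\<close>)
  then show ?thesis by (simp add: pt_open_def set_eq_iff) metis
qed

lemma istopology_pt_open: "istopology (\<lambda>W. \<exists>U\<in>carrier X. W = pt_open X U)"
  unfolding istopology_def
proof (intro conjI allI impI)
  fix V W
  assume "\<exists>U\<in>carrier X. V = pt_open X U" "\<exists>U\<in>carrier X. W = pt_open X U"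
  then show "\<exists>U\<in>carrier X. V \<inter> W = pt_open X U"
    using pt_open_meet meet_closed by metis
next
  fix K
  assume K: "\<forall>W\<in>K. \<exists>U\<in>carrier X. W = pt_open X U"
  let ?A = "{U \<in> carrier X. pt_open X U \<in> K}"
  have A: "?A \<subseteq> carrier X" by simp
  have "K = pt_open X ` ?A" using K by fast
  then have "\<Union>K = pt_open X (\<Squnion>?A)" using pt_open_Sup[OF A] by simp
  then show "\<exists>U\<in>carrier X. \<Union>K = pt_open X U" using sup_closed[OF A] by (rule bexI)
qed

end

lemma is_open_pt:
  assumes "is_ordered_locale X"
  shows "is_open (pt X) W \<longleftrightarrow> (\<exists>U\<in>carrier X. W = pt_open X U)"
proof -
  have "frame X" using assms by (simp add: is_ordered_locale_def)
  from frame.istopology_pt_open[OF this] show ?thesis by (simp add: pt_def)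
qed

lemma points_pt:
  assumes "is_ordered_locale X"
  shows "points (pt X) = {F. cp_filter X F}"
proof -
  have "frame X" using assms by (simp add: is_ordered_locale_def)
  then interpret frame X .
  have top: "\<top>\<^bsub>X\<^esub> \<in> carrier X" by simp
  have eq: "{F. cp_filter X F} = pt_open X \<top>\<^bsub>X\<^esub>" by (auto simp: pt_open_def cp_filter_def)
  have "is_open (pt X) {F. cp_filter X F}"
    unfolding is_open_pt[OF assms] using eq top by (rule bexI)
  then have "{F. cp_filter X F} \<subseteq> points (pt X)" by (rule openin_subset)
  moreover have "points (pt X) \<subseteq> {F. cp_filter X F}"
    using openin_topspace[of "space_top (pt X)"] is_open_pt[OF assms]
    by (auto simp: pt_open_def)
  ultimately show ?thesis by (rule subset_antisym[rotated])
qed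

end

theory Submission
  imports Defs
begin

text \<open>
  Open cones make the neighbourhood filter map \<open>S \<rightarrow> pt (Loc S)\<close> monotone, and enough points
  identify every point of \<open>Loc S\<close> with a point of \<open>S\<close>, whence axiom \<open>(\<bullet>)\<close> for \<open>Loc S\<close>. Conversely,
  axiom \<open>(\<bullet>)\<close> computes the cones of \<open>pt X\<close>: \<open>\<up>pt(U)\<close> is the union of the \<open>pt(V)\<close> with \<open>U \<unlhd> V\<close>,
  hence open. As \<open>\<unlhd>\<close> respects joins, there is a largest \<open>V\<close> with \<open>U \<unlhd> V\<close>, and it witnesses the
  monotonicity of the counit \<open>U \<mapsto> pt(U)\<close>.
\<close>

section \<open>The frame of open sets\<close>

lemma carrier_Loc: "carrier (Loc S) = {U. is_open S U}"
  by (simp add: Loc_def)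

lemma le_Loc: "U \<sqsubseteq>\<^bsub>Loc S\<^esub> V \<longleftrightarrow> U \<subseteq> V"
  by (simp add: Loc_def)

lemma cone_rel_Loc:
  "U \<unlhd>\<^bsub>Loc S\<^esub> V \<longleftrightarrow> is_open S U \<and> is_open S V \<and> U \<subseteq> down_cone S V \<and> V \<subseteq> up_cone S U"
  by (simp add: Loc_def)

text \<open>Arbitrary unions of opens are open, so joins are unions; meets are then obtained as
  joins of lower bounds.\<close>

lemma complete_lattice_Loc: "complete_lattice (Loc S)"
proof -
  interpret partial_order "Loc S"
    by standard (auto simp: Loc_def)
  show ?thesis
  proof (rule complete_latticeI)
    fix A
    assume A: "A \<subseteq> carrier (Loc S)"
    have "least (Loc S) (\<Union>A) (Upper (Loc S) A)"
      using A by (intro least_UpperI) (auto simp: carrier_Loc le_Loc Upper_def)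
    then show "\<exists>s. least (Loc S) s (Upper (Loc S) A)" ..
    \<comment> \<open>An infinite intersection of opens need not be open, so the meet is the largest
      open lower bound, the union of all of them.\<close>
    let ?B = "Lower (Loc S) A"
    have "?B \<subseteq> carrier (Loc S)" by simp
    then have "greatest (Loc S) (\<Union>?B) ?B"
      using A by (intro greatest_LowerI) (auto simp: carrier_Loc le_Loc Lower_def)
    then show "\<exists>i. greatest (Loc S) i ?B" ..
  qed
qed

lemma Sup_Loc:
  assumes "A \<subseteq> carrier (Loc S)"
  shows "\<Squnion>\<^bsub>Loc S\<^esub>A = \<Union>A"
proof -
  interpret complete_lattice "Loc S" by (rule complete_lattice_Loc)
  have "\<Union>A \<in> carrier (Loc S)" using assms by (auto simp: carrier_Loc)
  from sup_least[OF assms this] sup_upper[OF assms] show ?thesis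
    unfolding le_Loc by blast
qed

lemma meet_Loc:
  assumes "is_open S U" "is_open S V"
  shows "U \<sqinter>\<^bsub>Loc S\<^esub> V = U \<inter> V"
proof -
  interpret complete_lattice "Loc S" by (rule complete_lattice_Loc)
  have c: "U \<in> carrier (Loc S)" "V \<in> carrier (Loc S)" "U \<inter> V \<in> carrier (Loc S)"
    using assms by (auto simp: carrier_Loc)
  have "U \<inter> V \<subseteq> U \<sqinter>\<^bsub>Loc S\<^esub> V"
    using meet_le[of "U \<inter> V" U V] c by (simp add: le_Loc)
  with meet_left[OF c(1,2)] meet_right[OF c(1,2)] show ?thesis
    unfolding le_Loc by blast
qed

lemma top_Loc: "\<top>\<^bsub>Loc S\<^esub> = points S"
proof -
  interpret complete_lattice "Loc S" by (rule complete_lattice_Loc)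
  have "points S \<in> carrier (Loc S)" by (simp add: carrier_Loc)
  from top_higher[OF this] top_closed show ?thesis
    by (auto simp: le_Loc carrier_Loc dest: openin_subset)
qed

text \<open>Joins and binary meets are unions and intersections, so the infinite distributive law is
  the one for sets.\<close>

lemma frame_Loc: "frame (Loc S)"
proof -
  interpret complete_lattice "Loc S" by (rule complete_lattice_Loc)
  show ?thesis
  proof
    fix U A
    assume U: "U \<in> carrier (Loc S)" and A: "A \<subseteq> carrier (Loc S)"
    have V: "is_open S V" if "V \<in> A" for V using A that by (auto simp: carrier_Loc)
    have eq: "(\<lambda>V. U \<sqinter>\<^bsub>Loc S\<^esub> V) ` A = (\<lambda>V. U \<inter> V) ` A"
      using U V by (intro image_cong refl meet_Loc) (auto simp: carrier_Loc)
    have "(\<lambda>V. U \<inter> V) ` A \<subseteq> carrier (Loc S)" using U V by (auto simp: carrier_Loc)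
    moreover have "is_open S (\<Union>A)" using V by auto
    ultimately show "U \<sqinter>\<^bsub>Loc S\<^esub> \<Squnion>\<^bsub>Loc S\<^esub>A = \<Squnion>\<^bsub>Loc S\<^esub>((\<lambda>V. U \<sqinter>\<^bsub>Loc S\<^esub> V) ` A)"
      using U A by (simp add: eq Sup_Loc meet_Loc carrier_Loc)
  qed
qed

text \<open>Since \<open>f\<close> takes open values, the abstract joins and meets on the side of
  \<open>Loc S\<close> can be replaced by set operations; frame homomorphisms into
  \<open>Loc S\<close> are checked in this form below.\<close>

lemma frame_hom_Loc_iff:
  assumes "frame X"
  shows "f \<in> frame_hom X (Loc S) \<longleftrightarrow>
    f \<in> carrier X \<rightarrow>\<^sub>E {U. is_open S U} \<and> f \<top>\<^bsub>X\<^esub> = points S \<and>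
    (\<forall>U\<in>carrier X. \<forall>V\<in>carrier X. f (U \<sqinter>\<^bsub>X\<^esub> V) = f U \<inter> f V) \<and>
    (\<forall>A\<subseteq>carrier X. f (\<Squnion>\<^bsub>X\<^esub>A) = \<Union>(f ` A))"
proof (cases "f \<in> carrier X \<rightarrow>\<^sub>E {U. is_open S U}")
  case True
  have "\<Squnion>\<^bsub>Loc S\<^esub>(f ` A) = \<Union>(f ` A)" if "A \<subseteq> carrier X" for A
    using True that by (intro Sup_Loc) (auto simp: carrier_Loc)
  moreover have "f U \<sqinter>\<^bsub>Loc S\<^esub> f V = f U \<inter> f V" if "U \<in> carrier X" "V \<in> carrier X" for U V
    using True that by (intro meet_Loc) auto
  ultimately show ?thesis
    by (simp add: frame_hom_def carrier_Loc top_Loc)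
next
  case False
  then show ?thesis by (simp add: frame_hom_def carrier_Loc)
qed

section \<open>Completely prime filters: preimages and neighbourhood filters\<close>

lemma frame_hom_cp_filter:
  assumes L: "frame L" and M: "frame M" and h: "h \<in> frame_hom L M" and F: "cp_filter M F"
  shows "cp_filter L {U \<in> carrier L. h U \<in> F}"
proof -
  interpret L: frame L by fact
  interpret M: frame M by fact
  have hc: "h U \<in> carrier M" if "U \<in> carrier L" for U
    using h that by (auto simp: frame_hom_def)
  have up: "V \<in> F" if "U \<in> F" "V \<in> carrier M" "U \<sqsubseteq>\<^bsub>M\<^esub> V" for U V
    using F that by (simp add: cp_filter_def)
  have "h V \<in> F" if "U \<in> carrier L" "h U \<in> F" "V \<in> carrier L" "U \<sqsubseteq>\<^bsub>L\<^esub> V" for U V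
    using up[OF that(2) hc[OF that(3)]]
      frame_hom_mono[OF h L.complete_lattice_axioms M.complete_lattice_axioms that(1,3,4)] .
  moreover have "\<exists>U\<in>A. U \<in> carrier L \<and> h U \<in> F" if A: "A \<subseteq> carrier L" and "h (\<Squnion>\<^bsub>L\<^esub>A) \<in> F" for A
  proof -
    have "\<Squnion>\<^bsub>M\<^esub>(h ` A) \<in> F" using h that by (simp add: frame_hom_def)
    moreover have "h ` A \<subseteq> carrier M" using A hc by auto
    ultimately have "\<exists>V\<in>h ` A. V \<in> F" using F by (simp only: cp_filter_def)
    then show ?thesis using A by blast
  qed
  moreover have "h (U \<sqinter>\<^bsub>L\<^esub> V) \<in> F"
    if "U \<in> carrier L" "V \<in> carrier L" "h U \<in> F" "h V \<in> F" for U V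
    using h F that by (simp add: frame_hom_def cp_filter_def)
  moreover have "h \<top>\<^bsub>L\<^esub> \<in> F" using h F by (simp add: frame_hom_def cp_filter_def)
  ultimately show ?thesis
    unfolding cp_filter_def by auto
qed

text \<open>Complete primality holds because joins in \<open>Loc S\<close> are unions: a point of a
  union lies in some member.\<close>

lemma cp_filter_nhds:
  assumes "x \<in> points S"
  shows "cp_filter (Loc S) {U. is_open S U \<and> x \<in> U}"
proof -
  have "\<exists>U\<in>A. x \<in> U" if "A \<subseteq> carrier (Loc S)" "x \<in> \<Squnion>\<^bsub>Loc S\<^esub>A" for A
    using that by (simp add: Sup_Loc)
  then show ?thesis
    using assms by (auto simp: cp_filter_def carrier_Loc top_Loc le_Loc meet_Loc)
qed

section \<open>The functor \<open>Loc\<close>\<close>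

text \<open>Reflexivity and transitivity are inherited pointwise from \<le>. For joins, a point of
  the union lies in one component of some pair in \<open>R\<close>, and its witness lies in the
  other component of the same pair.\<close>

lemma is_ordered_locale_Loc:
  assumes S: "is_ordered_space S"
  shows "is_ordered_locale (Loc S)"
proof -
  have refl: "(x, x) \<in> space_le S" if "is_open S U" "x \<in> U" for U x
    using S that openin_subset[OF that(1)]
    by (auto simp: is_ordered_space_def preorder_on_def refl_on_def)
  have trans: "(x, z) \<in> space_le S" if "(x, y) \<in> space_le S" "(y, z) \<in> space_le S" for x y z
    using S that by (auto simp: is_ordered_space_def preorder_on_def dest: transD)
  have "preorder_on (carrier (Loc S)) (cone_rel (Loc S))"
    unfolding preorder_on_def
  proof (intro conjI)
    show "cone_rel (Loc S) \<subseteq> carrier (Loc S) \<times> carrier (Loc S)" by (auto simp: Loc_def)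
    show "refl_on (carrier (Loc S)) (cone_rel (Loc S))"
      by (rule refl_onI) (auto simp: Loc_def up_cone_def down_cone_def intro: refl)
    show "trans (cone_rel (Loc S))"
    proof (rule transI)
      fix U V W
      assume "U \<unlhd>\<^bsub>Loc S\<^esub> V" "V \<unlhd>\<^bsub>Loc S\<^esub> W"
      then show "U \<unlhd>\<^bsub>Loc S\<^esub> W"
        unfolding cone_rel_Loc up_cone_def down_cone_def subset_iff mem_Collect_eq
        by (meson trans)
    qed
  qed
  moreover have "\<Squnion>\<^bsub>Loc S\<^esub>(fst ` R) \<unlhd>\<^bsub>Loc S\<^esub> \<Squnion>\<^bsub>Loc S\<^esub>(snd ` R)" if R: "R \<subseteq> cone_rel (Loc S)" for R
  proof -
    have R': "is_open S U \<and> is_open S V \<and> U \<subseteq> down_cone S V \<and> V \<subseteq> up_cone S U"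
      if "(U, V) \<in> R" for U V
      using R that by (auto simp: Loc_def)
    have "fst ` R \<subseteq> carrier (Loc S)" "snd ` R \<subseteq> carrier (Loc S)"
      using R' by (auto simp: carrier_Loc)
    moreover have "is_open S (\<Union>(fst ` R))" "is_open S (\<Union>(snd ` R))"
      using R' by auto
    moreover have "\<Union>(fst ` R) \<subseteq> down_cone S (\<Union>(snd ` R))"
      using R' unfolding down_cone_def by fastforce
    moreover have "\<Union>(snd ` R) \<subseteq> up_cone S (\<Union>(fst ` R))"
      using R' unfolding up_cone_def by fastforce
    ultimately show ?thesis by (simp add: Sup_Loc cone_rel_Loc)
  qed
  ultimately show ?thesis by (simp add: is_ordered_locale_def frame_Loc)
qed

section \<open>Cones and axiom (\<bullet>) for \<open>Loc S\<close>\<close>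

text \<open>Open cones make \<open>up_cone S U\<close> an element of the frame, and reflexivity of
  \<le> gives the inclusion of \<open>U\<close> in its down cone. This is the canonical witness
  wherever some \<open>V\<close> above \<open>U\<close> is required; the dual lemma serves
  below.\<close>

lemma cone_rel_up_cone:
  assumes "is_ordered_space S" "open_cones S" "is_open S U"
  shows "U \<unlhd>\<^bsub>Loc S\<^esub> up_cone S U"
proof -
  have "(x, x) \<in> space_le S" if "x \<in> U" for x
    using assms(1) that openin_subset[OF assms(3)]
    by (auto simp: is_ordered_space_def preorder_on_def refl_on_def)
  then show ?thesis
    using assms by (auto simp: cone_rel_Loc open_cones_def up_cone_def down_cone_def)
qed

lemma cone_rel_down_cone:
  assumes "is_ordered_space S" "open_cones S" "is_open S V"
  shows "down_cone S V \<unlhd>\<^bsub>Loc S\<^esub> V"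
proof -
  have "(x, x) \<in> space_le S" if "x \<in> V" for x
    using assms(1) that openin_subset[OF assms(3)]
    by (auto simp: is_ordered_space_def preorder_on_def refl_on_def)
  then show ?thesis
    using assms by (auto simp: cone_rel_Loc open_cones_def up_cone_def down_cone_def)
qed

text \<open>If \<open>x\<close> lies in \<open>U\<close> and \<open>x\<close> \<le>
  \<open>y\<close>, then \<open>y\<close> lies in the up cone of \<open>U\<close>, which is an open
  set above \<open>U\<close>; dually with down cones.\<close>

lemma nhds_mono:
  assumes S: "is_ordered_space S" "open_cones S" and xy: "(x, y) \<in> space_le S"
  shows "({U. is_open S U \<and> x \<in> U}, {U. is_open S U \<and> y \<in> U}) \<in> space_le (pt (Loc S))"
proof -
  have "x \<in> points S" "y \<in> points S"
    using S(1) xy by (auto simp: is_ordered_space_def preorder_on_def)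
  moreover have "\<exists>V. is_open S V \<and> y \<in> V \<and> U \<unlhd>\<^bsub>Loc S\<^esub> V" if "is_open S U" "x \<in> U" for U
    using cone_rel_up_cone[OF S that(1)] that xy S(2)
    by (intro exI[of _ "up_cone S U"]) (auto simp: open_cones_def up_cone_def)
  moreover have "\<exists>V. is_open S V \<and> x \<in> V \<and> V \<unlhd>\<^bsub>Loc S\<^esub> U" if "is_open S U" "y \<in> U" for U
    using cone_rel_down_cone[OF S that(1)] that xy S(2)
    by (intro exI[of _ "down_cone S U"]) (auto simp: open_cones_def down_cone_def)
  ultimately show ?thesis
    by (simp add: pt_def cp_filter_nhds)
qed

text \<open>By enough points, a filter in \<open>pt_open (Loc S) U\<close> is the neighbourhood
  filter of some \<open>x\<close> in \<open>U\<close>. The Egli-Milner order of \<open>S\<close>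
  supplies a related point in \<open>V\<close>, and \<open>nhds_mono\<close> carries the relation
  over to the filters.\<close>

lemma Loc_in_OrdLoc_bullet:
  assumes "S \<in> OrdTop_OC_bullet"
  shows "Loc S \<in> OrdLoc_bullet"
proof -
  have S: "is_ordered_space S" "open_cones S" and en: "enough_points S"
    using assms by (simp_all add: OrdTop_OC_bullet_def)
  note L = is_ordered_locale_Loc[OF S(1)]
  have "pt_open (Loc S) U \<unlhd>\<^bsub>Loc (pt (Loc S))\<^esub> pt_open (Loc S) V" if UV: "U \<unlhd>\<^bsub>Loc S\<^esub> V" for U V
  proof -
    have nhds: "\<exists>x\<in>W. F = {U. is_open S U \<and> x \<in> U}" if "F \<in> pt_open (Loc S) W" for F W
      using en that by (auto simp: enough_points_def pt_open_def)
    have nhds_mem: "{U. is_open S U \<and> x \<in> U} \<in> pt_open (Loc S) W" if "is_open S W" "x \<in> W" for x W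
      using that openin_subset[OF that(1)] by (auto simp: pt_open_def intro: cp_filter_nhds)
    have o: "is_open S U" "is_open S V" using UV by (simp_all add: cone_rel_Loc)
    have "pt_open (Loc S) U \<subseteq> down_cone (pt (Loc S)) (pt_open (Loc S) V)"
    proof
      fix F
      assume "F \<in> pt_open (Loc S) U"
      then obtain x where x: "x \<in> U" "F = {U. is_open S U \<and> x \<in> U}" using nhds by blast
      then obtain y where "y \<in> V" "(x, y) \<in> space_le S"
        using UV by (auto simp: cone_rel_Loc down_cone_def)
      then show "F \<in> down_cone (pt (Loc S)) (pt_open (Loc S) V)"
        using nhds_mono[OF S] nhds_mem[OF o(2)] x(2) unfolding down_cone_def by blast
    qed
    moreover have "pt_open (Loc S) V \<subseteq> up_cone (pt (Loc S)) (pt_open (Loc S) U)"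
    proof
      fix G
      assume "G \<in> pt_open (Loc S) V"
      then obtain y where y: "y \<in> V" "G = {U. is_open S U \<and> y \<in> U}" using nhds by blast
      then obtain x where "x \<in> U" "(x, y) \<in> space_le S"
        using UV by (auto simp: cone_rel_Loc up_cone_def)
      then show "G \<in> up_cone (pt (Loc S)) (pt_open (Loc S) U)"
        using nhds_mono[OF S] nhds_mem[OF o(1)] y(2) unfolding up_cone_def by blast
    qed
    ultimately show ?thesis
      using o by (auto simp: cone_rel_Loc[where S = "pt (Loc S)"] is_open_pt[OF L] carrier_Loc)
  qed
  then show ?thesis using L by (simp add: OrdLoc_bullet_def axiom_bullet_def)
qed

section \<open>Action of \<open>Loc\<close> on morphisms\<close>

lemma Loc_map_frame_hom:
  assumes g: "continuous_map (space_top S) (space_top T) g"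
  shows "Loc_map S T g \<in> frame_hom (Loc T) (Loc S)"
proof -
  interpret complete_lattice "Loc T" by (rule complete_lattice_Loc)
  have "Loc_map S T g (\<Squnion>\<^bsub>Loc T\<^esub>A) = \<Union>(Loc_map S T g ` A)" if A: "A \<subseteq> carrier (Loc T)" for A
    using sup_closed[OF A] A by (auto simp: Loc_map_def Sup_Loc)
  moreover have "Loc_map S T g (U \<sqinter>\<^bsub>Loc T\<^esub> V) = Loc_map S T g U \<inter> Loc_map S T g V"
    if "U \<in> carrier (Loc T)" "V \<in> carrier (Loc T)" for U V
    using that by (auto simp: Loc_map_def meet_Loc carrier_Loc)
  moreover have "Loc_map S T g \<in> carrier (Loc T) \<rightarrow>\<^sub>E {U. is_open S U}"
    using g by (auto simp: Loc_map_def carrier_Loc openin_continuous_map_preimage)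
  moreover have "Loc_map S T g \<top>\<^bsub>Loc T\<^esub> = points S"
    using g by (auto simp: Loc_map_def carrier_Loc top_Loc continuous_map_def)
  ultimately show ?thesis
    by (simp add: frame_hom_Loc_iff[OF frame_Loc])
qed

text \<open>The witnesses are the up cone and the down cone taken in \<open>T\<close>: if
  \<open>x\<close> \<le> \<open>y\<close> and \<open>g x\<close> lies in \<open>V\<close>, then
  monotonicity of \<open>g\<close> puts \<open>g y\<close> into \<open>up_cone T V\<close>.\<close>

lemma Loc_map_hom:
  assumes S: "is_ordered_space S" and T: "is_ordered_space T" "open_cones T"
    and g: "g \<in> space_hom S T"
  shows "Loc_map S T g \<in> locale_hom (Loc S) (Loc T)"
proof (rule locale_homI)
  show "Loc_map S T g \<in> frame_hom (Loc T) (Loc S)"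
    using g by (intro Loc_map_frame_hom) (simp add: space_hom_def)
  have mono: "(g x, g y) \<in> space_le T" if "(x, y) \<in> space_le S" for x y
    using g that by (simp add: space_hom_def)
  have pts: "x \<in> points S" "y \<in> points S" if "(x, y) \<in> space_le S" for x y
    using S that by (auto simp: is_ordered_space_def preorder_on_def)
  show "\<exists>V'\<in>carrier (Loc T). V \<unlhd>\<^bsub>Loc T\<^esub> V' \<and> U' \<sqsubseteq>\<^bsub>Loc S\<^esub> Loc_map S T g V'"
    if UU: "U \<unlhd>\<^bsub>Loc S\<^esub> U'" and V: "V \<in> carrier (Loc T)" and le: "U \<sqsubseteq>\<^bsub>Loc S\<^esub> Loc_map S T g V"
    for U U' V
  proof (intro bexI conjI)
    show c: "up_cone T V \<in> carrier (Loc T)" using T V by (simp add: carrier_Loc open_cones_def)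
    show "V \<unlhd>\<^bsub>Loc T\<^esub> up_cone T V" using cone_rel_up_cone[OF T] V by (simp add: carrier_Loc)
    show "U' \<sqsubseteq>\<^bsub>Loc S\<^esub> Loc_map S T g (up_cone T V)"
      unfolding le_Loc
    proof
      fix y
      assume "y \<in> U'"
      then obtain x where "x \<in> U" "(x, y) \<in> space_le S"
        using UU by (auto simp: cone_rel_Loc up_cone_def)
      moreover from this have "g x \<in> V" using le V by (auto simp: le_Loc Loc_map_def)
      ultimately show "y \<in> Loc_map S T g (up_cone T V)"
        using c mono pts(2) by (auto simp: Loc_map_def up_cone_def)
    qed
  qed
  show "\<exists>V\<in>carrier (Loc T). V \<unlhd>\<^bsub>Loc T\<^esub> V' \<and> U \<sqsubseteq>\<^bsub>Loc S\<^esub> Loc_map S T g V"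
    if UU: "U \<unlhd>\<^bsub>Loc S\<^esub> U'" and V: "V' \<in> carrier (Loc T)" and le: "U' \<sqsubseteq>\<^bsub>Loc S\<^esub> Loc_map S T g V'"
    for U U' V'
  proof (intro bexI conjI)
    show c: "down_cone T V' \<in> carrier (Loc T)" using T V by (simp add: carrier_Loc open_cones_def)
    show "down_cone T V' \<unlhd>\<^bsub>Loc T\<^esub> V'" using cone_rel_down_cone[OF T] V by (simp add: carrier_Loc)
    show "U \<sqsubseteq>\<^bsub>Loc S\<^esub> Loc_map S T g (down_cone T V')"
      unfolding le_Loc
    proof
      fix x
      assume "x \<in> U"
      then obtain y where "y \<in> U'" "(x, y) \<in> space_le S"
        using UU by (auto simp: cone_rel_Loc down_cone_def)
      moreover from this have "g y \<in> V'" using le V by (auto simp: le_Loc Loc_map_def)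
      ultimately show "x \<in> Loc_map S T g (down_cone T V')"
        using c mono pts(1) by (auto simp: Loc_map_def down_cone_def)
    qed
  qed
qed

lemma Loc_map_id: "Loc_map S S (space_id S) = locale_id (Loc S)"
  by (auto simp: Loc_map_def space_id_def locale_id_def carrier_Loc fun_eq_iff restrict_def
      dest: openin_subset)

lemma Loc_map_comp:
  assumes g: "g \<in> space_hom S T" and h: "h \<in> space_hom T R"
  shows "Loc_map S R (space_comp S h g) = locale_comp (Loc R) (Loc_map T R h) (Loc_map S T g)"
proof
  fix W
  have "{x \<in> points S. g x \<in> {y \<in> points T. h y \<in> W}} = {x \<in> points S. space_comp S h g x \<in> W}"
    using g by (auto simp: space_hom_def space_comp_def compose_def)
  \<comment> \<open>Openness ensures that \<open>Loc_map S T g\<close> is evaluated inside its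
    domain, where it is not \<open>undefined\<close>.\<close>
  moreover have "is_open T {y \<in> points T. h y \<in> W}" if "is_open R W"
    using h that by (auto simp: space_hom_def openin_continuous_map_preimage)
  ultimately show "Loc_map S R (space_comp S h g) W =
      locale_comp (Loc R) (Loc_map T R h) (Loc_map S T g) W"
    by (simp add: Loc_map_def locale_comp_def compose_def carrier_Loc)
qed

section \<open>The functor \<open>pt\<close>\<close>

lemma is_ordered_localeD:
  assumes "is_ordered_locale X"
  shows "frame X"
    and "U \<unlhd>\<^bsub>X\<^esub> V \<Longrightarrow> U \<in> carrier X \<and> V \<in> carrier X"
    and "U \<in> carrier X \<Longrightarrow> U \<unlhd>\<^bsub>X\<^esub> U"
    and "U \<unlhd>\<^bsub>X\<^esub> V \<Longrightarrow> V \<unlhd>\<^bsub>X\<^esub> W \<Longrightarrow> U \<unlhd>\<^bsub>X\<^esub> W"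
    and "R \<subseteq> cone_rel X \<Longrightarrow> \<Squnion>\<^bsub>X\<^esub>(fst ` R) \<unlhd>\<^bsub>X\<^esub> \<Squnion>\<^bsub>X\<^esub>(snd ` R)"
  using assms by (auto simp: is_ordered_locale_def preorder_on_def refl_on_def dest: transD)

lemma space_le_pt:
  "(F, G) \<in> space_le (pt X) \<longleftrightarrow> cp_filter X F \<and> cp_filter X G \<and>
     (\<forall>U\<in>F. \<exists>V\<in>G. U \<unlhd>\<^bsub>X\<^esub> V) \<and> (\<forall>V\<in>G. \<exists>U\<in>F. U \<unlhd>\<^bsub>X\<^esub> V)"
  by (simp add: pt_def)

lemma is_ordered_space_pt:
  assumes X: "is_ordered_locale X"
  shows "is_ordered_space (pt X)"
proof -
  note D = is_ordered_localeD[OF X]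
  have "refl_on {F. cp_filter X F} (space_le (pt X))"
  proof (rule refl_onI)
    fix F
    assume "F \<in> {F. cp_filter X F}"
    then have F: "cp_filter X F" by simp
    then have "F \<subseteq> carrier X" by (simp add: cp_filter_def)
    then have "\<forall>U\<in>F. U \<unlhd>\<^bsub>X\<^esub> U" using D(3) by blast
    with F show "(F, F) \<in> space_le (pt X)" unfolding space_le_pt by blast
  qed
  moreover have "trans (space_le (pt X))"
    unfolding trans_def space_le_pt by (metis D(4))
  moreover have "space_le (pt X) \<subseteq> {F. cp_filter X F} \<times> {F. cp_filter X F}"
    by (auto simp: pt_def)
  ultimately show ?thesis
    by (simp add: is_ordered_space_def preorder_on_def points_pt[OF X])
qed

section \<open>The counit, and the cones and points of \<open>pt X\<close>\<close>

text \<open>This is the frame homomorphism that represents the counit \<open>Loc (pt X)\<close>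
  \<rightarrow> \<open>X\<close>; the restriction to the carrier makes it extensional, as morphisms
  have to be.\<close>

definition pt_counit :: "'a ordered_locale \<Rightarrow> 'a \<Rightarrow> 'a set set" where
  "pt_counit X = (\<lambda>U\<in>carrier X. pt_open X U)"

lemma pt_counit_frame_hom:
  assumes X: "is_ordered_locale X"
  shows "pt_counit X \<in> frame_hom X (Loc (pt X))"
proof -
  interpret frame X by (rule is_ordered_localeD[OF X])
  have "pt_counit X \<top>\<^bsub>X\<^esub> = points (pt X)"
    by (auto simp: pt_counit_def points_pt[OF X] pt_open_def cp_filter_def)
  moreover have "pt_counit X (\<Squnion>\<^bsub>X\<^esub>A) = \<Union>(pt_counit X ` A)" if A: "A \<subseteq> carrier X" for A
  proof -
    have "pt_counit X ` A = pt_open X ` A"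
      using A by (intro image_cong) (auto simp: pt_counit_def)
    then show ?thesis using pt_open_Sup[OF A] A by (simp add: pt_counit_def)
  qed
  ultimately show ?thesis
    unfolding frame_hom_Loc_iff[OF frame_axioms]
    by (auto simp: pt_counit_def is_open_pt[OF X] simp flip: pt_open_meet)
qed

text \<open>The inclusion from left to right is part of the definition of the order on filters: a
  member \<open>U\<close> of the lower filter has some \<open>V\<close> above it in the upper one.
  The converse inclusion is exactly what axiom (\<bullet>) provides.\<close>

lemma up_cone_pt_open:
  assumes b: "axiom_bullet X"
  shows "up_cone (pt X) (pt_open X U) = \<Union>(pt_open X ` {V. U \<unlhd>\<^bsub>X\<^esub> V})"
proof -
  have "pt_open X V \<subseteq> up_cone (pt X) (pt_open X U)" if "U \<unlhd>\<^bsub>X\<^esub> V" for V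
    using b that by (simp add: axiom_bullet_def cone_rel_Loc)
  moreover have "\<exists>V. U \<unlhd>\<^bsub>X\<^esub> V \<and> G \<in> pt_open X V" if "G \<in> up_cone (pt X) (pt_open X U)" for G
    using that by (auto simp: up_cone_def pt_open_def space_le_pt)
  ultimately show ?thesis by blast
qed

lemma down_cone_pt_open:
  assumes b: "axiom_bullet X"
  shows "down_cone (pt X) (pt_open X V) = \<Union>(pt_open X ` {U. U \<unlhd>\<^bsub>X\<^esub> V})"
proof -
  have "pt_open X U \<subseteq> down_cone (pt X) (pt_open X V)" if "U \<unlhd>\<^bsub>X\<^esub> V" for U
    using b that by (simp add: axiom_bullet_def cone_rel_Loc)
  moreover have "\<exists>U. U \<unlhd>\<^bsub>X\<^esub> V \<and> F \<in> pt_open X U" if "F \<in> down_cone (pt X) (pt_open X V)" for F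
    using that by (auto simp: down_cone_def pt_open_def space_le_pt)
  ultimately show ?thesis by blast
qed

text \<open>Pulling the given filter back along the counit yields a point \<open>?G\<close> of
  \<open>X\<close>. As every open set of \<open>pt X\<close> is some \<open>pt_open X U\<close>, the
  given filter is determined by \<open>?G\<close> and consists of its open neighbourhoods.\<close>

lemma enough_points_pt:
  assumes X: "is_ordered_locale X"
  shows "enough_points (pt X)"
  unfolding enough_points_def
proof (intro allI impI)
  fix \<F>
  assume F: "cp_filter (Loc (pt X)) \<F>"
  let ?G = "{U \<in> carrier X. pt_counit X U \<in> \<F>}"
  have G: "cp_filter X ?G"
    by (rule frame_hom_cp_filter[OF is_ordered_localeD(1)[OF X] frame_Loc pt_counit_frame_hom[OF X] F])
  have "W \<in> \<F> \<longleftrightarrow> ?G \<in> W" if "is_open (pt X) W" for W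
  proof -
    obtain U where U: "U \<in> carrier X" "W = pt_open X U"
      using \<open>is_open (pt X) W\<close> by (auto simp: is_open_pt[OF X])
    then have "?G \<in> W \<longleftrightarrow> U \<in> ?G" using G unfolding pt_open_def by blast
    then show ?thesis using U by (simp add: pt_counit_def)
  qed
  \<comment> \<open>The equivalence above covers open \<open>W\<close> only, so the members of the
    filter must be known to be open.\<close>
  moreover have o: "is_open (pt X) W" if "W \<in> \<F>" for W
    using F that by (auto simp: cp_filter_def carrier_Loc)
  ultimately have "\<F> = {W. is_open (pt X) W \<and> ?G \<in> W}" by blast
  with G show "\<exists>F\<in>points (pt X). \<F> = {W. is_open (pt X) W \<and> F \<in> W}"
    by (intro bexI[of _ ?G]) (simp_all only: points_pt[OF X] mem_Collect_eq)
qed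

text \<open>By the cone formulas, which rest on axiom (\<bullet>), the cones of a set
  \<open>pt_open X U\<close> are unions of sets of this kind; these are all the open sets of
  \<open>pt X\<close>.\<close>

lemma pt_in_OrdTop_OC_bullet:
  assumes "X \<in> OrdLoc_bullet"
  shows "pt X \<in> OrdTop_OC_bullet"
proof -
  have X: "is_ordered_locale X" and b: "axiom_bullet X"
    using assms by (simp_all add: OrdLoc_bullet_def)
  have "is_open (pt X) (\<Union>(pt_open X ` A))" if "A \<subseteq> carrier X" for A
    using that by (intro openin_Union) (auto simp: is_open_pt[OF X])
  moreover have "{V. U \<unlhd>\<^bsub>X\<^esub> V} \<subseteq> carrier X" "{V. V \<unlhd>\<^bsub>X\<^esub> U} \<subseteq> carrier X" for U
    using is_ordered_localeD(2)[OF X] by auto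
  ultimately have "is_open (pt X) (up_cone (pt X) (pt_open X U))"
    "is_open (pt X) (down_cone (pt X) (pt_open X U))" for U
    by (simp_all add: up_cone_pt_open[OF b] down_cone_pt_open[OF b])
  then have "open_cones (pt X)" by (auto simp: open_cones_def is_open_pt[OF X])
  then show ?thesis
    using is_ordered_space_pt[OF X] enough_points_pt[OF X] by (simp add: OrdTop_OC_bullet_def)
qed

section \<open>Action of \<open>pt\<close> on morphisms\<close>

text \<open>Continuity holds because the preimage of \<open>pt_open Y V\<close> is
  \<open>pt_open X (f V)\<close>. The two halves of the order on filters come from the upper and
  lower conditions on \<open>f\<close>.\<close>

lemma pt_map_hom:
  assumes X: "is_ordered_locale X" and Y: "is_ordered_locale Y" and f: "f \<in> locale_hom X Y"
  shows "pt_map X Y f \<in> space_hom (pt X) (pt Y)"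
proof -
  note frX = is_ordered_localeD(1)[OF X] and frY = is_ordered_localeD(1)[OF Y]
  interpret X: frame X by (rule frX)
  have ff: "f \<in> frame_hom Y X" using f by (simp add: locale_hom_def)
  have fc: "f V \<in> carrier X" if "V \<in> carrier Y" for V
    using ff that by (auto simp: frame_hom_def)
  have cp: "cp_filter Y {V \<in> carrier Y. f V \<in> F}" if "cp_filter X F" for F
    using frame_hom_cp_filter[OF frY frX ff that] .
  have up: "V \<in> F" if "cp_filter X F" "U \<in> F" "V \<in> carrier X" "U \<sqsubseteq>\<^bsub>X\<^esub> V" for F U V
    using that by (simp add: cp_filter_def)
  have pre: "{F \<in> points (pt X). pt_map X Y f F \<in> pt_open Y V} = pt_open X (f V)"
    if "V \<in> carrier Y" for V
    using that cp by (auto simp: points_pt[OF X] pt_map_def pt_open_def)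
  have "pt_map X Y f F \<in> points (pt Y)" if "F \<in> points (pt X)" for F
    using that cp by (simp add: points_pt[OF X] points_pt[OF Y] pt_map_def)
  moreover have "is_open (pt X) {F \<in> points (pt X). pt_map X Y f F \<in> W}" if "is_open (pt Y) W" for W
  proof -
    obtain V where "V \<in> carrier Y" "W = pt_open Y V"
      using \<open>is_open (pt Y) W\<close> by (auto simp: is_open_pt[OF Y])
    then show ?thesis using pre fc unfolding is_open_pt[OF X] by blast
  qed
  moreover have "pt_map X Y f \<in> extensional (points (pt X))"
    by (simp add: points_pt[OF X] pt_map_def)
  moreover have "(pt_map X Y f F, pt_map X Y f G) \<in> space_le (pt Y)"
    if FG: "(F, G) \<in> space_le (pt X)" for F G
  proof -
    have F: "cp_filter X F" and G: "cp_filter X G" using FG by (simp_all add: space_le_pt)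
    have "\<exists>V'\<in>carrier Y. f V' \<in> G \<and> V \<unlhd>\<^bsub>Y\<^esub> V'" if V: "V \<in> carrier Y" "f V \<in> F" for V
    proof -
      obtain U' where "U' \<in> G" "f V \<unlhd>\<^bsub>X\<^esub> U'" using FG V by (auto simp: space_le_pt)
      \<comment> \<open>The upper condition is applied with \<open>f V\<close> itself as the smaller
        element, so its inclusion premise is reflexivity; it gives \<open>V'\<close> above
        \<open>V\<close> with \<open>U'\<close> below \<open>f V'\<close>, and \<open>G\<close> is
        upward closed.\<close>
      then show ?thesis
        using locale_hom_upper[OF f _ V(1)] X.le_refl[OF fc[OF V(1)]] up[OF G] fc by metis
    qed
    moreover have "\<exists>V\<in>carrier Y. f V \<in> F \<and> V \<unlhd>\<^bsub>Y\<^esub> V'" if V: "V' \<in> carrier Y" "f V' \<in> G" for V'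
    proof -
      obtain U where "U \<in> F" "U \<unlhd>\<^bsub>X\<^esub> f V'" using FG V by (auto simp: space_le_pt)
      then show ?thesis
        using locale_hom_lower[OF f _ V(1)] X.le_refl[OF fc[OF V(1)]] up[OF F] fc by metis
    qed
    ultimately show ?thesis
      using F G cp by (simp add: pt_map_def space_le_pt Bex_def conj_assoc)
  qed
  ultimately show ?thesis
    by (auto simp: space_hom_def continuous_map_def PiE_def)
qed

lemma pt_map_id:
  assumes "is_ordered_locale X"
  shows "pt_map X X (locale_id X) = space_id (pt X)"
proof -
  have "{U \<in> carrier X. locale_id X U \<in> F} = F" if "cp_filter X F" for F
    using that by (auto simp: locale_id_def cp_filter_def)
  then show ?thesis
    by (simp add: pt_map_def space_id_def points_pt[OF assms] cong: restrict_cong)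
qed

lemma pt_map_comp:
  assumes X: "is_ordered_locale X" and Y: "is_ordered_locale Y"
    and f: "f \<in> locale_hom X Y" and h: "h \<in> locale_hom Y Z"
  shows "pt_map X Z (locale_comp Z h f) = space_comp (pt X) (pt_map Y Z h) (pt_map X Y f)"
proof
  fix F
  have hc: "h W \<in> carrier Y" if "W \<in> carrier Z" for W
    using h that by (auto simp: locale_hom_def frame_hom_def)
  \<comment> \<open>Without this, \<open>pt_map Y Z h\<close> could not be unfolded at the image of
    \<open>F\<close>, being \<open>undefined\<close> away from completely prime filters.\<close>
  have "cp_filter Y {V \<in> carrier Y. f V \<in> F}" if "cp_filter X F"
    using f frame_hom_cp_filter[OF is_ordered_localeD(1)[OF Y] is_ordered_localeD(1)[OF X] _ that]
    by (simp add: locale_hom_def)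
  then show "pt_map X Z (locale_comp Z h f) F =
      space_comp (pt X) (pt_map Y Z h) (pt_map X Y f) F"
    using hc
    by (simp add: pt_map_def space_comp_def locale_comp_def compose_def points_pt[OF X]
        cong: conj_cong)
qed

section \<open>The adjunction\<close>

text \<open>The upper witness is the join of all \<open>V'\<close> above \<open>V\<close>. If
  \<open>F\<close> \<le> \<open>G\<close> and \<open>V\<close> is in \<open>F\<close>, then some
  such \<open>V'\<close> is in \<open>G\<close>, and hence so is the join. The lower condition is
  dual, with the join of all elements below \<open>V'\<close>.\<close>

lemma pt_counit_hom:
  assumes X: "is_ordered_locale X"
  shows "pt_counit X \<in> locale_hom (Loc (pt X)) X"
proof (rule locale_homI)
  interpret frame X by (rule is_ordered_localeD[OF X])
  note D = is_ordered_localeD[OF X]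
  show "pt_counit X \<in> frame_hom X (Loc (pt X))" by (rule pt_counit_frame_hom[OF X])
  have mem: "V \<in> F" if "cp_filter X F" "U \<in> F" "V \<in> carrier X" "U \<sqsubseteq>\<^bsub>X\<^esub> V" for F U V
    using that by (simp add: cp_filter_def)
  show "\<exists>V'\<in>carrier X. V \<unlhd>\<^bsub>X\<^esub> V' \<and> W' \<sqsubseteq>\<^bsub>Loc (pt X)\<^esub> pt_counit X V'"
    if WW: "W \<unlhd>\<^bsub>Loc (pt X)\<^esub> W'" and V: "V \<in> carrier X" and le: "W \<sqsubseteq>\<^bsub>Loc (pt X)\<^esub> pt_counit X V"
    for W W' V
  proof -
    let ?A = "{V'. V \<unlhd>\<^bsub>X\<^esub> V'}"
    have A: "?A \<subseteq> carrier X" using D(2) by blast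
    \<comment> \<open>Reflexivity makes \<open>?A\<close> nonempty, so the first projection is all
      of \<open>{V}\<close>; closure of \<unlhd> under joins, applied to this constant family, then
      relates \<open>V\<close> to the join of \<open>?A\<close>.\<close>
    have "fst ` ({V} \<times> ?A) = {V}" "snd ` ({V} \<times> ?A) = ?A" using D(3)[OF V] by auto
    then have cone: "V \<unlhd>\<^bsub>X\<^esub> \<Squnion>\<^bsub>X\<^esub>?A" using D(5)[of "{V} \<times> ?A"] V by auto
    have "G \<in> pt_open X (\<Squnion>\<^bsub>X\<^esub>?A)" if m: "G \<in> W'" for G
    proof -
      obtain F where F: "F \<in> W" "(F, G) \<in> space_le (pt X)"
        using WW m by (auto simp: cone_rel_Loc up_cone_def)
      then have "V \<in> F" using le V by (auto simp: le_Loc pt_counit_def pt_open_def)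
      then obtain V' where "V' \<in> G" "V \<unlhd>\<^bsub>X\<^esub> V'" "cp_filter X G"
        using F(2) by (auto simp: space_le_pt)
      then show ?thesis using mem sup_upper[OF A] sup_closed[OF A] by (auto simp: pt_open_def)
    qed
    then show ?thesis using cone sup_closed[OF A]
      by (intro bexI[of _ "\<Squnion>\<^bsub>X\<^esub>?A"]) (auto simp: le_Loc pt_counit_def)
  qed
  show "\<exists>V\<in>carrier X. V \<unlhd>\<^bsub>X\<^esub> V' \<and> W \<sqsubseteq>\<^bsub>Loc (pt X)\<^esub> pt_counit X V"
    if WW: "W \<unlhd>\<^bsub>Loc (pt X)\<^esub> W'" and V: "V' \<in> carrier X" and le: "W' \<sqsubseteq>\<^bsub>Loc (pt X)\<^esub> pt_counit X V'"
    for W W' V'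
  proof -
    let ?A = "{V. V \<unlhd>\<^bsub>X\<^esub> V'}"
    have A: "?A \<subseteq> carrier X" using D(2) by blast
    have "fst ` (?A \<times> {V'}) = ?A" "snd ` (?A \<times> {V'}) = {V'}" using D(3)[OF V] by auto
    then have cone: "\<Squnion>\<^bsub>X\<^esub>?A \<unlhd>\<^bsub>X\<^esub> V'" using D(5)[of "?A \<times> {V'}"] V by auto
    have "F \<in> pt_open X (\<Squnion>\<^bsub>X\<^esub>?A)" if m: "F \<in> W" for F
    proof -
      obtain G where G: "G \<in> W'" "(F, G) \<in> space_le (pt X)"
        using WW m by (auto simp: cone_rel_Loc down_cone_def)
      then have "V' \<in> G" using le V by (auto simp: le_Loc pt_counit_def pt_open_def)
      then obtain V where "V \<in> F" "V \<unlhd>\<^bsub>X\<^esub> V'" "cp_filter X F"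
        using G(2) by (auto simp: space_le_pt)
      then show ?thesis using mem sup_upper[OF A] sup_closed[OF A] by (auto simp: pt_open_def)
    qed
    then show ?thesis using cone sup_closed[OF A]
      by (intro bexI[of _ "\<Squnion>\<^bsub>X\<^esub>?A"]) (auto simp: le_Loc pt_counit_def)
  qed
qed

text \<open>This is the unit of the adjunction. It is continuous because the preimage of
  \<open>pt_open (Loc S) U\<close> is \<open>U\<close>, and monotone by
  \<open>nhds_mono\<close>.\<close>

lemma pt_unit_hom:
  assumes S: "is_ordered_space S" "open_cones S"
  shows "(\<lambda>x\<in>points S. {U. is_open S U \<and> x \<in> U}) \<in> space_hom S (pt (Loc S))" (is "?n \<in> _")
proof -
  note L = is_ordered_locale_Loc[OF S(1)]
  have pts: "x \<in> points S" "y \<in> points S" if "(x, y) \<in> space_le S" for x y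
    using S(1) that by (auto simp: is_ordered_space_def preorder_on_def)
  have pre: "{x \<in> points S. ?n x \<in> pt_open (Loc S) U} = U" if "is_open S U" for U
    using that openin_subset[OF that] by (auto simp: pt_open_def cp_filter_nhds)
  have "is_open S {x \<in> points S. ?n x \<in> W}" if "is_open (pt (Loc S)) W" for W
  proof -
    obtain U where "is_open S U" "W = pt_open (Loc S) U"
      using \<open>is_open (pt (Loc S)) W\<close> by (auto simp: is_open_pt[OF L] carrier_Loc)
    then show ?thesis using pre by simp
  qed
  then show ?thesis
    using nhds_mono[OF S] pts
    by (auto simp: space_hom_def continuous_map_def points_pt[OF L] cp_filter_nhds)
qed

section \<open>Transposition and its naturality\<close>

text \<open>Writing the transpose as \<open>pt_map\<close> after the unit reduces its being a
  morphism, and its naturality in the locale, to functoriality of \<open>pt\<close>.\<close>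

lemma adj_transpose_eq:
  assumes S: "is_ordered_space S" and f: "f \<in> locale_hom (Loc S) X"
  shows "adj_transpose S X f =
    space_comp S (pt_map (Loc S) X f) (\<lambda>x\<in>points S. {U. is_open S U \<and> x \<in> U})"
proof
  fix x
  have "is_open S (f U)" if "U \<in> carrier X" for U
    using f that by (auto simp: locale_hom_def frame_hom_def carrier_Loc)
  then show "adj_transpose S X f x =
    space_comp S (pt_map (Loc S) X f) (\<lambda>x\<in>points S. {U. is_open S U \<and> x \<in> U}) x"
    by (auto simp: adj_transpose_def space_comp_def compose_def pt_map_def cp_filter_nhds)
qed

lemma adj_transpose_hom:
  assumes S: "is_ordered_space S" "open_cones S" and X: "is_ordered_locale X"
    and f: "f \<in> locale_hom (Loc S) X"
  shows "adj_transpose S X f \<in> space_hom S (pt X)"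
  unfolding adj_transpose_eq[OF S(1) f]
  by (rule space_comp_hom[OF pt_unit_hom[OF S] pt_map_hom[OF is_ordered_locale_Loc[OF S(1)] X f] S(1)])

text \<open>The inverse sends \<open>g\<close> to the counit after
  \<open>Loc_map S (pt X) g\<close>. Both round trips then amount to \<open>U\<close> belonging to
  the filter at \<open>x\<close> exactly when \<open>x\<close> lies in the open set assigned to
  \<open>U\<close>.\<close>

lemma adj_transpose_bij:
  assumes S: "is_ordered_space S" "open_cones S" and X: "is_ordered_locale X" "axiom_bullet X"
  shows "bij_betw (adj_transpose S X) (locale_hom (Loc S) X) (space_hom S (pt X))"
proof (rule bij_betw_byWitness)
  note L = is_ordered_locale_Loc[OF S(1)]
  \<comment> \<open>Axiom (\<bullet>) enters here: it makes the cones of \<open>pt X\<close> open,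
    as \<open>Loc_map_hom\<close> demands of the target space.\<close>
  have P: "is_ordered_space (pt X)" "open_cones (pt X)"
    using pt_in_OrdTop_OC_bullet[of X] X
    by (simp_all add: OrdLoc_bullet_def OrdTop_OC_bullet_def)
  let ?w = "\<lambda>g. locale_comp X (pt_counit X) (Loc_map S (pt X) g)"
  have w: "?w g U = (if U \<in> carrier X then {x \<in> points S. g x \<in> pt_open X U} else undefined)" for g U
    by (auto simp: locale_comp_def compose_def pt_counit_def Loc_map_def carrier_Loc is_open_pt[OF X(1)])
  show "adj_transpose S X ` locale_hom (Loc S) X \<subseteq> space_hom S (pt X)"
    using adj_transpose_hom[OF S X(1)] by auto
  show "?w ` space_hom S (pt X) \<subseteq> locale_hom (Loc S) X"
    using locale_comp_hom[OF Loc_map_hom[OF S(1) P] pt_counit_hom[OF X(1)] L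
        is_ordered_locale_Loc[OF P(1)] X(1)] by auto
  show "\<forall>f\<in>locale_hom (Loc S) X. ?w (adj_transpose S X f) = f"
  proof (intro ballI ext)
    fix f U
    assume f: "f \<in> locale_hom (Loc S) X"
    then have fh: "f \<in> frame_hom X (Loc S)" by (simp add: locale_hom_def)
    have "cp_filter X (adj_transpose S X f x)" if "x \<in> points S" for x
      using adj_transpose_hom[OF S X(1) f] that by (auto simp: space_hom_def points_pt[OF X(1)])
    \<comment> \<open>The set computed by \<open>?w\<close> contains only points of
      \<open>S\<close>, so recovering all of \<open>f U\<close> needs this inclusion.\<close>
    moreover have "f U \<subseteq> points S" if "U \<in> carrier X"
      using fh that by (auto simp: frame_hom_def carrier_Loc dest!: PiE_mem openin_subset)
    moreover have "f U = undefined" if "U \<notin> carrier X"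
      using fh that by (auto simp: frame_hom_def)
    ultimately show "?w (adj_transpose S X f) U = f U"
      by (auto simp: w pt_open_def) (auto simp: adj_transpose_def)
  qed
  show "\<forall>g\<in>space_hom S (pt X). adj_transpose S X (?w g) = g"
  proof (intro ballI ext)
    fix g x
    assume g: "g \<in> space_hom S (pt X)"
    \<comment> \<open>In particular \<open>g x\<close> is contained in the carrier of
      \<open>X\<close>, so collecting its members there recovers all of \<open>g x\<close>.\<close>
    have "cp_filter X (g x)" if "x \<in> points S"
      using g that by (auto simp: space_hom_def points_pt[OF X(1)])
    moreover have "g x = undefined" if "x \<notin> points S"
      using g that by (auto simp: space_hom_def)
    ultimately show "adj_transpose S X (?w g) x = g x"
      by (auto simp: adj_transpose_def w pt_open_def cp_filter_def)
  qed
qed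

text \<open>At a point \<open>x\<close> of \<open>S\<close>, both sides are the set of those
  \<open>U\<close> for which \<open>g x\<close> lies in \<open>f U\<close>.\<close>

lemma adj_transpose_natural_space:
  assumes g: "g \<in> space_hom S T" and f: "f \<in> locale_hom (Loc T) X"
  shows "adj_transpose S X (locale_comp X f (Loc_map S T g)) = space_comp S (adj_transpose T X f) g"
proof
  fix x
  have "g x \<in> points T" if "x \<in> points S" using g that by (auto simp: space_hom_def)
  moreover have "f U \<in> carrier (Loc T)" if "U \<in> carrier X" for U
    using f that by (auto simp: locale_hom_def frame_hom_def)
  ultimately show "adj_transpose S X (locale_comp X f (Loc_map S T g)) x =
      space_comp S (adj_transpose T X f) g x"
    by (auto simp: adj_transpose_def locale_comp_def space_comp_def compose_def Loc_map_def)
qed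

text \<open>Once both transposes are written through the unit, the claim is that \<open>pt\<close>
  preserves composition, followed by associativity.\<close>

lemma adj_transpose_natural_locale:
  assumes S: "is_ordered_space S" "open_cones S"
    and X: "is_ordered_locale X" and Y: "is_ordered_locale Y"
    and f: "f \<in> locale_hom (Loc S) X" and h: "h \<in> locale_hom X Y"
  shows "adj_transpose S Y (locale_comp Y h f) = space_comp S (pt_map X Y h) (adj_transpose S X f)"
proof -
  note L = is_ordered_locale_Loc[OF S(1)]
  show ?thesis
    unfolding adj_transpose_eq[OF S(1) f] adj_transpose_eq[OF S(1) locale_comp_hom[OF f h L X Y]]
      pt_map_comp[OF L X f h]
    by (rule space_comp_assoc[OF pt_unit_hom[OF S], symmetric])
qed

theorem theorem5p45:
  shows
   \<comment> \<open>\<open>Loc\<close> is a functor\<close>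
   "(\<forall>S\<in>(OrdTop_OC_bullet :: 'a ordered_space set). Loc S \<in> OrdLoc_bullet)
  \<and> (\<forall>S\<in>(OrdTop_OC_bullet :: 'a ordered_space set).
     \<forall>T\<in>(OrdTop_OC_bullet :: 'b ordered_space set).
     \<forall>g\<in>space_hom S T. Loc_map S T g \<in> locale_hom (Loc S) (Loc T))
  \<and> (\<forall>S\<in>(OrdTop_OC_bullet :: 'a ordered_space set).
       Loc_map S S (space_id S) = locale_id (Loc S))
  \<and> (\<forall>S\<in>(OrdTop_OC_bullet :: 'a ordered_space set).
     \<forall>T\<in>(OrdTop_OC_bullet :: 'b ordered_space set).
     \<forall>R\<in>(OrdTop_OC_bullet :: 'c ordered_space set).
     \<forall>g\<in>space_hom S T. \<forall>h\<in>space_hom T R.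
       Loc_map S R (space_comp S h g) = locale_comp (Loc R) (Loc_map T R h) (Loc_map S T g))

   \<comment> \<open>\<open>pt\<close> is a functor\<close>
  \<and> (\<forall>X\<in>(OrdLoc_bullet :: 'x ordered_locale set). pt X \<in> OrdTop_OC_bullet)
  \<and> (\<forall>X\<in>(OrdLoc_bullet :: 'x ordered_locale set).
     \<forall>Y\<in>(OrdLoc_bullet :: 'y ordered_locale set).
     \<forall>f\<in>locale_hom X Y. pt_map X Y f \<in> space_hom (pt X) (pt Y))
  \<and> (\<forall>X\<in>(OrdLoc_bullet :: 'x ordered_locale set).
       pt_map X X (locale_id X) = space_id (pt X))
  \<and> (\<forall>X\<in>(OrdLoc_bullet :: 'x ordered_locale set).
     \<forall>Y\<in>(OrdLoc_bullet :: 'y ordered_locale set).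
     \<forall>Z\<in>(OrdLoc_bullet :: 'z ordered_locale set).
     \<forall>f\<in>locale_hom X Y. \<forall>h\<in>locale_hom Y Z.
       pt_map X Z (locale_comp Z h f) = space_comp (pt X) (pt_map Y Z h) (pt_map X Y f))

   \<comment> \<open>bijection between morphisms \<open>Loc S \<rightarrow> X\<close> and \<open>S \<rightarrow> pt X\<close>, natural in \<open>S\<close> and in \<open>X\<close>\<close>
  \<and> (\<forall>S\<in>(OrdTop_OC_bullet :: 'a ordered_space set).
     \<forall>X\<in>(OrdLoc_bullet :: 'x ordered_locale set).
       bij_betw (adj_transpose S X) (locale_hom (Loc S) X) (space_hom S (pt X)))
  \<and> (\<forall>S\<in>(OrdTop_OC_bullet :: 'a ordered_space set).
     \<forall>T\<in>(OrdTop_OC_bullet :: 'b ordered_space set).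
     \<forall>X\<in>(OrdLoc_bullet :: 'x ordered_locale set).
     \<forall>g\<in>space_hom S T. \<forall>f\<in>locale_hom (Loc T) X.
       adj_transpose S X (locale_comp X f (Loc_map S T g)) = space_comp S (adj_transpose T X f) g)
  \<and> (\<forall>S\<in>(OrdTop_OC_bullet :: 'a ordered_space set).
     \<forall>X\<in>(OrdLoc_bullet :: 'x ordered_locale set).
     \<forall>Y\<in>(OrdLoc_bullet :: 'y ordered_locale set).
     \<forall>f\<in>locale_hom (Loc S) X. \<forall>h\<in>locale_hom X Y.
       adj_transpose S Y (locale_comp Y h f) = space_comp S (pt_map X Y h) (adj_transpose S X f))"
  apply (intro conjI ballI)
  subgoal by (rule Loc_in_OrdLoc_bullet)
  subgoal by (rule Loc_map_hom) (simp_all add: OrdTop_OC_bullet_def)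
  subgoal by (rule Loc_map_id)
  subgoal by (rule Loc_map_comp)
  subgoal by (rule pt_in_OrdTop_OC_bullet)
  subgoal by (rule pt_map_hom) (simp_all add: OrdLoc_bullet_def)
  subgoal by (rule pt_map_id) (simp add: OrdLoc_bullet_def)
  subgoal by (rule pt_map_comp) (simp_all add: OrdLoc_bullet_def)
  subgoal by (rule adj_transpose_bij) (simp_all add: OrdTop_OC_bullet_def OrdLoc_bullet_def)
  subgoal by (rule adj_transpose_natural_space)
  subgoal by (rule adj_transpose_natural_locale) (simp_all add: OrdTop_OC_bullet_def OrdLoc_bullet_def)
  done

end
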